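(* Let $(\mathbb{Q}, \preccurlyeq_1, \preccurlyeq_2)$ be the generic permutation (in its reflexive version), i.e. the Fraïssé limit, with underlying set $\mathbb{Q}$, of the class of all finite permutations, and define $\preccurlyeq$ on $\mathbb{Q}$ by $$a \preccurlyeq b \iff a \preccurlyeq_1 b \text{ and } a \preccurlyeq_2 b.$$ Then $(\mathbb{Q}, \preccurlyeq)$ is the generic 2-dimensional poset; that is, $(\mathbb{Q}, \preccurlyeq)$ is the weak Fraïssé limit of the class $\mathbf{K}_{\leqslant 2}$ of all finite at most 2-dimensional posets.
   Context: A finite permutation is a structure $(A, \leqslant_1, \leqslant_2)$ where $A$ is a finite set and $\leqslant_1$, $\leqslant_2$ are two (reflexive) linear orders on $A$. The class of finite permutations is a Fraïssé class; its Fraïssé limit $(\mathbb{Q}, \preccurlyeq_1, \preccurlyeq_2)$ is the unique (up to isomorphism) countable ultrahomogeneous structure with two linear orders into which every finite permutation embeds. An embedding of relational structures is an injective map that preserves and reflects all the relations. The dimension of a finite partially ordered set $(P, \preccurlyeq)$ is the least number of linear extensions of $\preccurlyeq$ whose intersection is $\preccurlyeq$. Equivalently, it is the least number $d$ of finite linear orders $L_1, \ldots, L_d$ such that $(P, \preccurlyeq)$ embeds into $L_1 \times \cdots \times L_d$ with the componentwise order. A finite poset is at most 2-dimensional if its dimension is $\leqslant 2$, i.e. if its order is the intersection of two (possibly equal) linear orders on its underlying set. $\mathbf{K}_{\leqslant 2}$ denotes the class of all finite at most 2-dimensional posets. The age $\mathrm{Age}(\Omega)$ of a countable relational structure $\Omega$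 is the class of all finite structures that embed into $\Omega$. Let $\mathbf{K}$ be the age of a countable relational structure over a relational language. Consider the space of all structures on the set $\omega = \{0,1,2,\ldots\}$ whose age is $\mathbf{K}$, with the topology whose basic open sets consist of all structures in the space inducing a prescribed structure on a prescribed finite subset of $\omega$ (for $\mathbf{K}_{\leqslant 2}$ this is the subspace topology inherited from $\{0,1\}^{\omega \times \omega}$, identifying a partial order on $\omega$ with its characteristic function). This is a Baire space. A countably infinite structure $\Omega$ is the weak Fraïssé limit of $\mathbf{K}$, and is called generic among countable structures whose age is $\mathbf{K}$, if $\mathrm{Age}(\Omega) = \mathbf{K}$ and the set of all structures on $\omega$ that are isomorphic to $\Omega$ is comeager in this space. (Such a structure is unique up to isomorphism, and it is known to exist whenever $\mathbf{K}$ has the joint embedding property and the weak amalgamation property.) The generic 2-dimensional poset is the weak Fraïssé limit of $\mathbf{K}_{\leqslant 2}$. *)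

theory Defs
  imports "HOL-Analysis.Analysis"
begin

section \<open>Relational structures\<close>

text \<open>
  All relation symbols involved are binary, so a relational structure is a carrier set together
  with a family of binary relations on it, indexed by the type \<open>'i\<close> of relation symbols. A poset
  is a structure over the one-element language \<open>unit\<close>; a permutation is a structure over
  \<open>bool\<close>, with \<open>True\<close> and \<open>False\<close> naming the first and the second order.
\<close>

type_synonym ('i, 'a) relstruct = "'a set \<times> ('i \<Rightarrow> 'a rel)"

definition relational_structure :: "('i, 'a) relstruct \<Rightarrow> bool" where
  "relational_structure M \<longleftrightarrow> (\<forall>i. snd M i \<subseteq> fst M \<times> fst M)"

definition embedding :: "('a \<Rightarrow> 'b) \<Rightarrow> ('i, 'a) relstruct \<Rightarrow> ('i, 'b) relstruct \<Rightarrow> bool" where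
  "embedding f M N \<longleftrightarrow>
     f ` fst M \<subseteq> fst N \<and> inj_on f (fst M) \<and>
     (\<forall>i. \<forall>x\<in>fst M. \<forall>y\<in>fst M. (x, y) \<in> snd M i \<longleftrightarrow> (f x, f y) \<in> snd N i)"

definition isomorphism :: "('a \<Rightarrow> 'b) \<Rightarrow> ('i, 'a) relstruct \<Rightarrow> ('i, 'b) relstruct \<Rightarrow> bool" where
  "isomorphism f M N \<longleftrightarrow> embedding f M N \<and> f ` fst M = fst N"

definition isomorphic :: "('i, 'a) relstruct \<Rightarrow> ('i, 'b) relstruct \<Rightarrow> bool" where
  "isomorphic M N \<longleftrightarrow> (\<exists>f. isomorphism f M N)"

definition substructure :: "('i, 'a) relstruct \<Rightarrow> 'a set \<Rightarrow> ('i, 'a) relstruct" where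
  "substructure M B = (B, \<lambda>i. snd M i \<inter> B \<times> B)"

definition ultrahomogeneous :: "('i, 'a) relstruct \<Rightarrow> bool" where
  "ultrahomogeneous M \<longleftrightarrow>
     (\<forall>B C f. finite B \<and> B \<subseteq> fst M \<and> C \<subseteq> fst M \<and>
        isomorphism f (substructure M B) (substructure M C) \<longrightarrow>
        (\<exists>g. isomorphism g M M \<and> (\<forall>x\<in>B. g x = f x)))"

text \<open>
  A class of finite structures is represented by its members with carrier a finite set of
  natural numbers. Every finite structure is isomorphic to one of these, so two
  isomorphism-closed classes of finite structures are equal iff they have the same
  representatives.
\<close>

definition age :: "('i, 'a) relstruct \<Rightarrow> ('i, nat) relstruct set" where
  "age M = {N. relational_structure N \<and> finite (fst N) \<and> (\<exists>f. embedding f N M)}"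


section \<open>Fraisse limits and weak Fraisse limits\<close>

definition fraisse_limit :: "('i, nat) relstruct set \<Rightarrow> ('i, 'a) relstruct \<Rightarrow> bool" where
  "fraisse_limit K M \<longleftrightarrow>
     relational_structure M \<and> countable (fst M) \<and> ultrahomogeneous M \<and> age M = K"

definition structures_with_age :: "('i, nat) relstruct set \<Rightarrow> ('i \<Rightarrow> nat rel) set" where
  "structures_with_age K = {S. age (UNIV, S) = K}"

text \<open>
  A basic open set prescribes the structure \<open>T\<close> on the finite set \<open>F\<close>.
\<close>

definition structure_space :: "('i, nat) relstruct set \<Rightarrow> ('i \<Rightarrow> nat rel) topology" where
  "structure_space K = topology_generated_by
     {{S \<in> structures_with_age K. substructure (UNIV, S) F = substructure (UNIV, T) F} | F T.
        finite F}"

lemma topspace_structure_space: "topspace (structure_space K) = structures_with_age K"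
proof -
  have "\<exists>F T. finite F \<and> substructure (UNIV, S) F = substructure (UNIV, T) F"
    for S :: "'i \<Rightarrow> nat rel"
    by blast
  then show ?thesis
    unfolding structure_space_def topology_generated_by_topspace by blast
qed

definition nowhere_dense_in :: "'a topology \<Rightarrow> 'a set \<Rightarrow> bool" where
  "nowhere_dense_in X N \<longleftrightarrow> N \<subseteq> topspace X \<and> X interior_of (X closure_of N) = {}"

definition meager_in :: "'a topology \<Rightarrow> 'a set \<Rightarrow> bool" where
  "meager_in X M \<longleftrightarrow> (\<exists>\<N>. countable \<N> \<and> (\<forall>N\<in>\<N>. nowhere_dense_in X N) \<and> M = \<Union>\<N>)"

definition comeager_in :: "'a topology \<Rightarrow> 'a set \<Rightarrow> bool" where
  "comeager_in X M \<longleftrightarrow> M \<subseteq> topspace X \<and> meager_in X (topspace X - M)"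

definition weak_fraisse_limit :: "('i, nat) relstruct set \<Rightarrow> ('i, 'a) relstruct \<Rightarrow> bool" where
  "weak_fraisse_limit K M \<longleftrightarrow>
     relational_structure M \<and> countable (fst M) \<and> infinite (fst M) \<and> age M = K \<and>
     comeager_in (structure_space K) {S \<in> structures_with_age K. isomorphic (UNIV, S) M}"


section \<open>Finite permutations\<close>

definition permutation_structure :: "'a set \<Rightarrow> 'a rel \<Rightarrow> 'a rel \<Rightarrow> (bool, 'a) relstruct" where
  "permutation_structure A r1 r2 = (A, \<lambda>i. if i then r1 else r2)"

definition finite_permutations :: "(bool, nat) relstruct set" where
  "finite_permutations =
     {permutation_structure A r1 r2 | A r1 r2.
        finite A \<and> linear_order_on A r1 \<and> linear_order_on A r2}"


section \<open>Finite posets of dimension at most two\<close>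

definition poset_structure :: "'a set \<Rightarrow> 'a rel \<Rightarrow> (unit, 'a) relstruct" where
  "poset_structure A r = (A, \<lambda>_. r)"

definition linear_extension :: "'a set \<Rightarrow> 'a rel \<Rightarrow> 'a rel \<Rightarrow> bool" where
  "linear_extension A r L \<longleftrightarrow> linear_order_on A L \<and> r \<subseteq> L"

text \<open>
  The intersection is taken inside \<open>A \<times> A\<close>, so that the intersection of the empty family is
  \<open>A \<times> A\<close>, and posets with at most one element have dimension 0 (the empty product of linear
  orders has exactly one element).
\<close>

definition realizer :: "'a set \<Rightarrow> 'a rel \<Rightarrow> 'a rel set \<Rightarrow> bool" where
  "realizer A r \<L> \<longleftrightarrow> (\<forall>L\<in>\<L>. linear_extension A r L) \<and> r = A \<times> A \<inter> \<Inter>\<L>"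

definition poset_dimension :: "'a set \<Rightarrow> 'a rel \<Rightarrow> nat" where
  "poset_dimension A r = (LEAST d. \<exists>\<L>. finite \<L> \<and> card \<L> = d \<and> realizer A r \<L>)"

definition finite_posets_dim_le_2 :: "(unit, nat) relstruct set" where
  "finite_posets_dim_le_2 =
     {poset_structure A r | A r. finite A \<and> partial_order_on A r \<and> poset_dimension A r \<le> 2}"

text \<open>
  Every finite poset has a finite realizer, so the minimum defining the dimension exists;
  moreover, dimension at most two means being the intersection of two linear orders.
\<close>

lemma partial_order_on_add_pair:
  assumes r: "partial_order_on A r" and "u \<in> A" "v \<in> A" "(v, u) \<notin> r"
  shows "partial_order_on A (r \<union> {(a, b). (a, u) \<in> r \<and> (v, b) \<in> r})"
proof -
  have sub: "r \<subseteq> A \<times> A" and re: "refl_on A r" and tr: "trans r" and an: "antisym r"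
    using r by (auto simp: order_on_defs)
  have "trans (r \<union> {(a, b). (a, u) \<in> r \<and> (v, b) \<in> r})"
    by (rule transI) (use assms(4) in \<open>auto dest: transD[OF tr]\<close>)
  moreover have "antisym (r \<union> {(a, b). (a, u) \<in> r \<and> (v, b) \<in> r})"
    by (rule antisymI) (use assms(4) in \<open>auto dest: transD[OF tr] antisymD[OF an]\<close>)
  ultimately show ?thesis
    using sub re by (auto simp: order_on_defs refl_on_def)
qed

lemma finite_linear_extension:
  assumes "finite A" "partial_order_on A r"
  shows "\<exists>L. linear_extension A r L"
proof -
  let ?E = "{q. partial_order_on A q \<and> r \<subseteq> q}"
  have "?E \<subseteq> Pow (A \<times> A)" by (auto simp: order_on_defs)
  then have "finite ?E" using assms(1) by (meson finite_Pow_iff finite_SigmaI finite_subset)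
  moreover have "r \<in> ?E" using assms(2) by simp
  ultimately obtain q where q: "q \<in> ?E" and max: "\<forall>q'\<in>?E. q \<le> q' \<longrightarrow> q = q'"
    using finite_has_maximal2[of ?E r] by blast
  have "total_on A q"
    unfolding total_on_def
  proof (intro ballI impI)
    fix u v assume uv: "u \<in> A" "v \<in> A" "u \<noteq> v"
    show "(u, v) \<in> q \<or> (v, u) \<in> q"
    proof (rule ccontr)
      assume n: "\<not> ((u, v) \<in> q \<or> (v, u) \<in> q)"
      let ?q = "q \<union> {(a, b). (a, u) \<in> q \<and> (v, b) \<in> q}"
      have "partial_order_on A ?q"
        by (rule partial_order_on_add_pair) (use q uv n in simp_all)
      moreover have "r \<subseteq> ?q" using q by (intro le_supI1) simp
      ultimately have "?q \<in> ?E" by (intro CollectI conjI)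
      from max[rule_format, OF this Un_upper1] have "?q \<subseteq> q" by (rule equalityD2)
      moreover have "(u, u) \<in> q" "(v, v) \<in> q"
        using q uv by (simp_all add: order_on_defs refl_on_def)
      then have "(u, v) \<in> ?q" by simp
      ultimately have "(u, v) \<in> q" by (rule subsetD)
      then show False using n by simp
    qed
  qed
  then show ?thesis using q unfolding linear_extension_def linear_order_on_def by blast
qed

lemma finite_realizer_exists:
  assumes "finite A" "partial_order_on A r"
  shows "\<exists>\<L>. finite \<L> \<and> realizer A r \<L>"
proof (intro exI conjI)
  let ?L = "{L. linear_extension A r L}"
  have "?L \<subseteq> Pow (A \<times> A)" by (auto simp: linear_extension_def order_on_defs)
  then show "finite ?L" using assms(1) by (meson finite_Pow_iff finite_SigmaI finite_subset)
  have "(v, u) \<in> r" if vu: "v \<in> A" "u \<in> A" "(v, u) \<in> \<Inter>?L" for u v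
  proof (rule ccontr)
    assume n: "(v, u) \<notin> r"
    let ?q = "r \<union> {(a, b). (a, u) \<in> r \<and> (v, b) \<in> r}"
    obtain L where L: "linear_extension A ?q L"
      using finite_linear_extension[OF assms(1) partial_order_on_add_pair[OF assms(2) vu(2,1) n]]
      by blast
    have "(u, u) \<in> r" "(v, v) \<in> r"
      using assms(2) vu by (auto simp: order_on_defs refl_on_def)
    then have "(u, v) \<in> L" "u \<noteq> v" using L n by (auto simp: linear_extension_def)
    moreover have "linear_extension A r L" using L by (auto simp: linear_extension_def)
    ultimately show False
      using vu(3) by (auto simp: linear_extension_def order_on_defs antisym_def)
  qed
  moreover have "r \<subseteq> A \<times> A" using assms(2) by (auto simp: order_on_defs)
  ultimately show "realizer A r ?L"
    unfolding realizer_def by (auto simp: linear_extension_def)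
qed

lemma poset_dimension_le_2_iff:
  assumes "finite A" "partial_order_on A r"
  shows "poset_dimension A r \<le> 2 \<longleftrightarrow>
    (\<exists>L1 L2. linear_order_on A L1 \<and> linear_order_on A L2 \<and> r = L1 \<inter> L2)"
proof
  assume le: "poset_dimension A r \<le> 2"
  have "\<exists>\<L>. finite \<L> \<and> card \<L> = poset_dimension A r \<and> realizer A r \<L>"
    unfolding poset_dimension_def
    by (rule LeastI_ex) (use finite_realizer_exists[OF assms] in auto)
  then obtain \<L> where \<L>: "finite \<L>" "card \<L> \<le> 2" "realizer A r \<L>" using le by auto
  obtain L where L: "linear_extension A r L" using finite_linear_extension[OF assms] by blast
  then have LA: "L \<subseteq> A \<times> A" by (auto simp: linear_extension_def order_on_defs)
  consider "\<L> = {}" | L1 where "\<L> = {L1}" | L1 L2 where "\<L> = {L1, L2}"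
  proof -
    have "card \<L> = 0 \<or> card \<L> = 1 \<or> card \<L> = 2" using \<L>(2) by linarith
    then show thesis
      using \<L>(1) that by (auto simp: card_1_singleton_iff card_2_iff)
  qed
  then show "\<exists>L1 L2. linear_order_on A L1 \<and> linear_order_on A L2 \<and> r = L1 \<inter> L2"
  proof cases
    case 1
    then have "r = L" using \<L>(3) L LA by (auto simp: realizer_def linear_extension_def)
    then show ?thesis using L by (auto simp: linear_extension_def)
  next
    case 2
    then have "linear_order_on A L1" "r = L1 \<inter> L1"
      using \<L>(3) by (auto simp: realizer_def linear_extension_def order_on_defs)
    then show ?thesis by blast
  next
    case 3
    then have "linear_order_on A L1" "linear_order_on A L2" "r = L1 \<inter> L2"
      using \<L>(3) by (auto simp: realizer_def linear_extension_def order_on_defs)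
    then show ?thesis by blast
  qed
next
  assume "\<exists>L1 L2. linear_order_on A L1 \<and> linear_order_on A L2 \<and> r = L1 \<inter> L2"
  then obtain L1 L2 where "linear_order_on A L1" "linear_order_on A L2" "r = L1 \<inter> L2" by blast
  then have "realizer A r {L1, L2}"
    by (auto simp: realizer_def linear_extension_def order_on_defs)
  then have "poset_dimension A r \<le> card {L1, L2}"
    unfolding poset_dimension_def by (intro Least_le exI[of _ "{L1, L2}"]) auto
  also have "\<dots> \<le> 2" by (simp add: card_insert_if)
  finally show "poset_dimension A r \<le> 2" .
qed

end

theory Submission
  imports Defs
begin

text \<open>
  Write \<open>M\<close> for the poset obtained by intersecting the two orders of the generic permutation.
  Its age consists of the finite posets of dimension at most two, because a finite poset with
  realizer \<open>L1, L2\<close> embeds into \<open>M\<close> along any embedding of the permutation \<open>(L1, L2)\<close>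
  (\<open>age_poset\<close>). However, \<open>M\<close> is not ultrahomogeneous: a finite poset can have several realizers,
  and two copies of it in \<open>M\<close> may carry different ones. The proof shows that this is the only
  obstruction, and that it disappears once the finite poset is seen inside a larger one.

  The first half is a criterion for an arbitrary countably infinite structure \<open>M\<close>
  (\<open>weak_fraisse_limit_ageI\<close>). Call \<open>(A, P)\<close> an amalgamation pair for \<open>M\<close> if for each embedding
  of the finite structure \<open>P\<close> into a structure \<open>N\<close> of the age, each embedding of \<open>P\<close> into \<open>M\<close>
  can be changed outside \<open>A\<close> so that it extends to \<open>N\<close>. If every finite subset \<open>A\<close> of \<open>M\<close> lies in
  a finite \<open>B\<close> forming an amalgamation pair with \<open>A\<close>, then \<open>M\<close> is the weak Fraisse limit of its
  age. Indeed, a back-and-forth construction between a structure \<open>S\<close> on \<open>\<nat>\<close> and \<open>M\<close>, whose finite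
  approximations are embeddings defined on the larger member of an amalgamation pair and trusted
  only on the smaller one, succeeds as soon as \<open>S\<close> satisfies countably many extension properties.
  Each of them is open, as it is witnessed by a finite part of \<open>S\<close>, and each is dense: given a
  finite part of \<open>S\<close>, the amalgamation pair embeds it into \<open>M\<close> compatibly with the current
  approximation, and this embedding extends to a bijection of \<open>\<nat>\<close> with \<open>M\<close>, which pulls \<open>M\<close> back
  to an isomorphic copy having the desired property for trivial reasons.

  The second half verifies the criterion (\<open>amalgamation_pair_exists\<close>). For a finite set \<open>A\<close> of points
  of the generic permutation, finitely many points are added so that every realizer of the resulting
  poset restricts on \<open>A\<close> to the two given orders, up to exchanging them
  (\<open>realizer_unique_up_to_swap\<close>). A realizer orients each incomparable pair, and comparabilities
  force the orientations of different pairs to agree; the added points connect all incomparable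
  pairs of \<open>A\<close> to one reference pair. Once the realizers on \<open>A\<close> are known to match, after exchanging
  the two orders if necessary, an amalgamation problem for posets becomes one for permutations,
  which ultrahomogeneity of the generic permutation solves.
\<close>


section \<open>Embeddings\<close>

lemma fst_substructure [simp]: "fst (substructure M B) = B"
  by (simp add: substructure_def)

lemma snd_substructure [simp]: "snd (substructure M B) i = snd M i \<inter> B \<times> B"
  by (simp add: substructure_def)

lemma embedding_comp:
  assumes "embedding f M N" "embedding g N P"
  shows "embedding (g \<circ> f) M P"
proof -
  have mem: "f x \<in> fst N" if "x \<in> fst M" for x
    using assms(1) that by (auto simp: embedding_def)
  then show ?thesis
    using assms unfolding embedding_def
    by (auto intro!: comp_inj_on inj_on_subset[of g "fst N"])
qed

lemma embedding_cong:
  assumes "\<And>x. x \<in> fst M \<Longrightarrow> f x = g x"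
  shows "embedding f M N \<longleftrightarrow> embedding g M N"
  unfolding embedding_def using assms by (simp cong: inj_on_cong image_cong)

lemma embedding_substructure_mono:
  assumes "B \<subseteq> C"
  shows "embedding id (substructure M B) (substructure M C)"
  using assms unfolding embedding_def by auto

lemma embedding_restrict_substructure:
  assumes "embedding f M N" "B \<subseteq> fst M"
  shows "embedding f (substructure M B) N"
  using assms unfolding embedding_def by (auto simp: inj_on_def subset_iff)

lemma isomorphism_comp:
  assumes "isomorphism f M N" "isomorphism g N P"
  shows "isomorphism (g \<circ> f) M P"
  using assms embedding_comp[of f M N g P] unfolding isomorphism_def
  by (metis image_comp)

lemma isomorphism_inv_into:
  assumes "isomorphism f M N"
  shows "isomorphism (inv_into (fst M) f) N M"
proof -
  have f: "embedding f M N" "f ` fst M = fst N" and inj: "inj_on f (fst M)"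
    using assms by (auto simp: isomorphism_def embedding_def)
  let ?g = "inv_into (fst M) f"
  have mem: "?g y \<in> fst M" "f (?g y) = y" if "y \<in> fst N" for y
    using that f(2) by (auto intro: inv_into_into f_inv_into_f)
  have "?g ` fst N = fst M"
    using inj f(2) by (metis inv_into_image_cancel order_refl)
  moreover have "inj_on ?g (fst N)"
    using f(2) by (simp add: inj_on_inv_into)
  ultimately show ?thesis
    using f(1) mem unfolding isomorphism_def embedding_def by auto
qed

lemma isomorphism_onto_image:
  assumes "embedding f M N"
  shows "isomorphism f M (substructure N (f ` fst M))"
  using assms unfolding isomorphism_def embedding_def by auto

lemma isomorphism_restrict:
  assumes "isomorphism f M N" "B \<subseteq> fst M"
  shows "isomorphism f (substructure M B) (substructure N (f ` B))"
  using isomorphism_onto_image[of f "substructure M B" N]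
    embedding_restrict_substructure[of f M N B] assms by (simp add: isomorphism_def)

lemma age_mono_embedding:
  assumes "embedding f M N"
  shows "age M \<subseteq> age N"
  using assms embedding_comp unfolding age_def by blast

lemma age_isomorphism:
  assumes "isomorphism f M N"
  shows "age M = age N"
proof -
  have "embedding f M N" "embedding (inv_into (fst M) f) N M"
    using isomorphism_inv_into[OF assms] assms by (auto simp: isomorphism_def)
  then show ?thesis by (intro equalityI age_mono_embedding)
qed

lemma finite_substructure_in_age:
  assumes "finite G" "G \<subseteq> fst M"
  shows "substructure M G \<in> age M"
  using assms unfolding age_def relational_structure_def embedding_def
  by (auto intro!: exI[of _ id])


section \<open>The topology of the space of structures\<close>

definition agree_on :: "nat set \<Rightarrow> ('i \<Rightarrow> nat rel) \<Rightarrow> ('i \<Rightarrow> nat rel) \<Rightarrow> bool" where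
  "agree_on F S T \<longleftrightarrow> substructure (UNIV, S) F = substructure (UNIV, T) F"

lemma agree_on_iff: "agree_on F S T \<longleftrightarrow> (\<forall>i. S i \<inter> F \<times> F = T i \<inter> F \<times> F)"
  unfolding agree_on_def substructure_def by (auto simp: fun_eq_iff)

lemma agree_on_mono: "agree_on F S T \<Longrightarrow> E \<subseteq> F \<Longrightarrow> agree_on E S T"
  unfolding agree_on_iff by blast

text \<open>
  The finite-agreement form of openness: the basic open sets around a point are closed under finite
  intersection, so every neighbourhood of \<open>S\<close> contains all structures that agree with \<open>S\<close> on a
  suitable finite set.
\<close>
lemma openin_structure_space_iff:
  "openin (structure_space K) U \<longleftrightarrow>
     U \<subseteq> structures_with_age K \<and>
     (\<forall>S\<in>U. \<exists>F. finite F \<and> (\<forall>T\<in>structures_with_age K. agree_on F T S \<longrightarrow> T \<in> U))"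
  (is "_ \<longleftrightarrow> _ \<and> (\<forall>S\<in>U. ?nbhd S U)")
proof
  assume op: "openin (structure_space K) U"
  have "generate_topology_on
     {{S \<in> structures_with_age K. substructure (UNIV, S) F = substructure (UNIV, T) F} | F T.
        finite F} U"
    using op unfolding structure_space_def openin_topology_generated_by_iff .
  then have "\<forall>S\<in>U. ?nbhd S U"
  proof induction
    case (Int a b)
    show ?case
    proof
      fix S assume "S \<in> a \<inter> b"
      then obtain F G where
        "finite F" "\<forall>T\<in>structures_with_age K. agree_on F T S \<longrightarrow> T \<in> a"
        "finite G" "\<forall>T\<in>structures_with_age K. agree_on G T S \<longrightarrow> T \<in> b"
        using Int.IH by blast
      then show "?nbhd S (a \<inter> b)"
        by (intro exI[of _ "F \<union> G"]) (meson IntI agree_on_mono finite_UnI inf_sup_ord(3,4))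
    qed
  next
    case (UN \<U>)
    then show ?case by (meson Union_iff)
  next
    case (Basis s)
    then show ?case by (fastforce simp: agree_on_def)
  qed simp
  moreover have "U \<subseteq> structures_with_age K"
    using openin_subset[OF op] by (simp add: topspace_structure_space)
  ultimately show "U \<subseteq> structures_with_age K \<and> (\<forall>S\<in>U. ?nbhd S U)" by blast
next
  assume U: "U \<subseteq> structures_with_age K \<and> (\<forall>S\<in>U. ?nbhd S U)"
  show "openin (structure_space K) U"
  proof (subst openin_subopen, intro ballI)
    fix S assume S: "S \<in> U"
    then obtain F where F: "finite F" "\<forall>T\<in>structures_with_age K. agree_on F T S \<longrightarrow> T \<in> U"
      using U by blast
    let ?B = "{T \<in> structures_with_age K. substructure (UNIV, T) F = substructure (UNIV, S) F}"
    have "openin (structure_space K) ?B"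
      unfolding structure_space_def
      by (rule topology_generated_by_Basis) (use F(1) in blast)
    moreover have "S \<in> ?B" using S U by blast
    moreover have "?B \<subseteq> U" using F(2) by (auto simp: agree_on_def)
    ultimately show "\<exists>V. openin (structure_space K) V \<and> S \<in> V \<and> V \<subseteq> U" by blast
  qed
qed

text \<open>
  A set containing a countable intersection of dense open sets is comeager. As meagerness asks for
  an exact decomposition of the complement of \<open>U\<close>, the complement of each \<open>D i\<close>, which is
  nowhere dense, is intersected with the complement of \<open>U\<close>.
\<close>
lemma comeager_in_structure_spaceI:
  assumes I: "countable I"
    and U: "U \<subseteq> structures_with_age K"
    and op: "\<And>i. i \<in> I \<Longrightarrow> openin (structure_space K) (D i)"
    and dense: "\<And>i S F. \<lbrakk>i \<in> I; S \<in> structures_with_age K; finite F\<rbrakk> \<Longrightarrow> \<exists>T\<in>D i. agree_on F T S"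
    and sub: "\<And>S. \<lbrakk>S \<in> structures_with_age K; \<forall>i\<in>I. S \<in> D i\<rbrakk> \<Longrightarrow> S \<in> U"
  shows "comeager_in (structure_space K) U"
proof -
  let ?X = "structure_space K" and ?Y = "structures_with_age K"
  let ?N = "\<lambda>i. (?Y - D i) \<inter> (?Y - U)"
  have "nowhere_dense_in ?X (?N i)" if i: "i \<in> I" for i
  proof -
    have cl: "closedin ?X (?Y - D i)"
      using op[OF i] by (metis openin_closedin_eq topspace_structure_space)
    then have "?X closure_of ?N i \<subseteq> ?Y - D i"
      by (intro closure_of_minimal) auto
    then have *: "?X interior_of (?X closure_of ?N i) \<subseteq> ?Y - D i"
      using interior_of_subset by fastforce
    have "?X interior_of (?X closure_of ?N i) = {}"
    proof (rule ccontr)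
      assume "?X interior_of (?X closure_of ?N i) \<noteq> {}"
      then obtain S where S: "S \<in> ?X interior_of (?X closure_of ?N i)" by blast
      obtain F where "finite F"
        "\<forall>T\<in>?Y. agree_on F T S \<longrightarrow> T \<in> ?X interior_of (?X closure_of ?N i)"
        using openin_interior_of[of ?X "?X closure_of ?N i"] S
        unfolding openin_structure_space_iff by blast
      moreover obtain T where "T \<in> D i" "agree_on F T S"
        using dense[OF i _ \<open>finite F\<close>, of S] S * by blast
      moreover have "D i \<subseteq> ?Y" using op[OF i] by (simp add: openin_structure_space_iff)
      ultimately show False using * by blast
    qed
    then show ?thesis
      unfolding nowhere_dense_in_def topspace_structure_space by blast
  qed
  moreover have "?Y - U = \<Union> (?N ` I)" using sub by blast
  moreover have "countable (?N ` I)" using I by simp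
  ultimately have "meager_in ?X (?Y - U)" unfolding meager_in_def by blast
  then show ?thesis using U by (simp add: comeager_in_def topspace_structure_space)
qed


section \<open>A criterion for weak Fraisse limits\<close>

text \<open>
  The requirement ranges over all embeddings \<open>f\<close> of \<open>P\<close> into \<open>M\<close>, even when \<open>P\<close> is itself a
  substructure of \<open>M\<close>. This makes the notion invariant under isomorphisms of \<open>P\<close>, so that it can be
  transported between \<open>M\<close> and structures on \<open>\<nat>\<close>; since \<open>M\<close> need not be ultrahomogeneous, the
  inclusion of \<open>P\<close> alone would not give that.
\<close>
definition amalgamation_pair ::
    "('i, 'a) relstruct \<Rightarrow> ('i, 'b) relstruct \<Rightarrow> 'b set \<Rightarrow> bool" where
  "amalgamation_pair M P A \<longleftrightarrow>
     (\<forall>N\<in>age M. \<forall>e f. embedding e P N \<and> embedding f P M \<longrightarrow>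
        (\<exists>k. embedding k N M \<and> (\<forall>x\<in>A. k (e x) = f x)))"

lemma amalgamation_pair_isomorphism:
  assumes iso: "isomorphism g P Q" and "A \<subseteq> fst P" and Q: "amalgamation_pair M Q (g ` A)"
  shows "amalgamation_pair M P A"
  unfolding amalgamation_pair_def
proof (intro ballI allI impI, elim conjE)
  fix N e f assume N: "N \<in> age M" and ef: "embedding e P N" "embedding f P M"
  let ?i = "inv_into (fst P) g"
  have i: "embedding ?i Q P" using isomorphism_inv_into[OF iso] by (simp add: isomorphism_def)
  obtain k where k: "embedding k N M" "\<forall>x\<in>g ` A. k ((e \<circ> ?i) x) = (f \<circ> ?i) x"
    using Q N embedding_comp[OF i ef(1)] embedding_comp[OF i ef(2)]
    unfolding amalgamation_pair_def by blast
  have "?i (g x) = x" if "x \<in> A" for x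
    using iso assms(2) that by (auto simp: isomorphism_def embedding_def intro: inv_into_f_f)
  then show "\<exists>k. embedding k N M \<and> (\<forall>x\<in>A. k (e x) = f x)" using k by fastforce
qed

lemma extend_finite_injection_to_bijection:
  fixes k :: "nat \<Rightarrow> 'a"
  assumes "finite E" "inj_on k E" "k ` E \<subseteq> Y" "countable Y" "infinite Y"
  shows "\<exists>\<pi>. bij_betw \<pi> UNIV Y \<and> (\<forall>x\<in>E. \<pi> x = k x)"
proof -
  have "infinite (UNIV - E)" "infinite (Y - k ` E)" "countable (Y - k ` E)"
    using assms by (auto simp: Diff_infinite_finite)
  then have "bij_betw (to_nat_on (UNIV - E)) (UNIV - E) UNIV"
    "bij_betw (from_nat_into (Y - k ` E)) UNIV (Y - k ` E)"
    by (auto intro: to_nat_on_infinite bij_betw_from_nat_into)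
  then obtain j where j: "bij_betw j (UNIV - E) (Y - k ` E)"
    using bij_betw_trans by blast
  let ?p = "\<lambda>x. if x \<in> E then k x else j x"
  have "bij_betw ?p E (k ` E)"
    using assms(2) by (auto simp: bij_betw_def cong: inj_on_cong)
  moreover have "bij_betw ?p (UNIV - E) (Y - k ` E)"
    using j by (subst bij_betw_cong[of _ _ j]) auto
  ultimately have "bij_betw ?p (E \<union> (UNIV - E)) (k ` E \<union> (Y - k ` E))"
    by (rule bij_betw_combine) blast
  moreover have "k ` E \<union> (Y - k ` E) = Y" using assms(3) by blast
  ultimately show ?thesis by (intro exI[of _ ?p]) simp
qed

text \<open>
  The source of all density arguments: whatever happens on a finite set can be realized inside an
  isomorphic copy of \<open>M\<close>.
\<close>
lemma finite_embedding_extends_to_copy: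
  fixes M :: "('i, 'a) relstruct"
  assumes "countable (fst M)" "infinite (fst M)" "finite E"
    and k: "embedding k (substructure (UNIV, S) E) M"
  shows "\<exists>\<pi> T. isomorphism \<pi> (UNIV, T) M \<and> agree_on E T S \<and> (\<forall>x\<in>E. \<pi> x = k x)"
proof -
  have "inj_on k E" "k ` E \<subseteq> fst M" using k by (auto simp: embedding_def)
  then obtain \<pi> where \<pi>: "bij_betw \<pi> UNIV (fst M)" "\<forall>x\<in>E. \<pi> x = k x"
    using extend_finite_injection_to_bijection assms(1-3) by metis
  define T where "T i = {(x, y). (\<pi> x, \<pi> y) \<in> snd M i}" for i
  have "isomorphism \<pi> (UNIV, T) M"
    using \<pi>(1) by (auto simp: isomorphism_def embedding_def bij_betw_def T_def)
  moreover have "agree_on E T S"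
    using k \<pi>(2) by (auto simp: agree_on_iff T_def embedding_def)
  ultimately show ?thesis using \<pi>(2) by blast
qed

text \<open>
  A position in the back-and-forth construction. The map \<open>h\<close> embeds all of \<open>G\<close>, but only its values
  on \<open>F\<close> are kept in later positions.
\<close>
definition approximation ::
    "('i, 'a) relstruct \<Rightarrow> ('i \<Rightarrow> nat rel) \<Rightarrow> nat set \<Rightarrow> nat set \<Rightarrow> (nat \<Rightarrow> 'a) \<Rightarrow> bool" where
  "approximation M S F G h \<longleftrightarrow>
     finite G \<and> F \<subseteq> G \<and> embedding h (substructure (UNIV, S) G) M \<and>
     amalgamation_pair M (substructure (UNIV, S) G) F"

definition extends_approximation ::
    "('i, 'a) relstruct \<Rightarrow> ('i \<Rightarrow> nat rel) \<Rightarrow> nat set \<Rightarrow> (nat \<Rightarrow> 'a) \<Rightarrow> nat \<Rightarrow> 'a \<Rightarrow>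
      nat set \<Rightarrow> nat set \<Rightarrow> (nat \<Rightarrow> 'a) \<Rightarrow> bool" where
  "extends_approximation M S F h n m F' G' h' \<longleftrightarrow>
     approximation M S F' G' h' \<and> insert n F \<subseteq> F' \<and> (\<forall>x\<in>F. h' x = h x) \<and> m \<in> h' ` F'"

lemma approximation_agree:
  assumes "approximation M S F G h" "agree_on G T S"
  shows "approximation M T F G h"
  using assms by (simp add: approximation_def agree_on_def)

lemma approximation_cong:
  assumes "\<And>x. x \<in> G \<Longrightarrow> h x = h' x"
  shows "approximation M S F G h \<longleftrightarrow> approximation M S F G h'"
  unfolding approximation_def using embedding_cong[of "substructure (UNIV, S) G" h h'] assms
  by simp

definition extension_property_at ::
    "('i, 'a) relstruct \<Rightarrow> nat set \<times> nat set \<times> (nat \<Rightarrow> 'a) \<times> nat \<times> 'a \<Rightarrow> ('i \<Rightarrow> nat rel) set" where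
  "extension_property_at M = (\<lambda>(F, G, h, n, m). {S \<in> structures_with_age (age M).
     approximation M S F G h \<longrightarrow> (\<exists>F' G' h'. extends_approximation M S F h n m F' G' h')})"

text \<open>
  Whether \<open>(F, G, h)\<close> is an approximation depends only on \<open>S\<close> restricted to the finite set \<open>G\<close>, so
  both its failure and the existence of an extension are witnessed by finite parts of \<open>S\<close>.
\<close>
lemma openin_extension_property_at:
  "openin (structure_space (age M)) (extension_property_at M (F, G, h, n, m))"
  unfolding openin_structure_space_iff
proof (intro conjI ballI)
  fix S assume S: "S \<in> extension_property_at M (F, G, h, n, m)"
  show "\<exists>E. finite E \<and> (\<forall>T\<in>structures_with_age (age M).
      agree_on E T S \<longrightarrow> T \<in> extension_property_at M (F, G, h, n, m))"
  proof (cases "approximation M S F G h")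
    case True
    then obtain F' G' h' where ext: "extends_approximation M S F h n m F' G' h'"
      using S by (auto simp: extension_property_at_def)
    then have "finite G'" by (simp add: extends_approximation_def approximation_def)
    moreover have "extends_approximation M T F h n m F' G' h'" if "agree_on G' T S" for T
      using ext approximation_agree[OF _ that, of M F' h'] by (auto simp: extends_approximation_def)
    ultimately show ?thesis
      by (intro exI[of _ G'] conjI) (auto simp: extension_property_at_def)
  next
    case False
    show ?thesis
    proof (cases "finite G")
      case True
      moreover have "\<not> approximation M T F G h" if "agree_on G T S" for T
        using False approximation_agree[of M T F G h S] that by (auto simp: agree_on_def)
      ultimately show ?thesis
        by (intro exI[of _ G]) (auto simp: extension_property_at_def)
    next
      case False
      then show ?thesis
        by (intro exI[of _ "{}"]) (auto simp: extension_property_at_def approximation_def)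
    qed
  qed
qed (auto simp: extension_property_at_def)

text \<open>
  If \<open>S\<close> is arbitrary and \<open>E\<close> is finite, the amalgamation pair of the approximation embeds the part
  of \<open>S\<close> on \<open>E \<union> G\<close> into \<open>M\<close> without moving the values on \<open>F\<close>. In a copy of \<open>M\<close> that extends this
  embedding, the isomorphism onto \<open>M\<close> itself provides the extended approximation.
\<close>
lemma dense_extension_property_at:
  fixes M :: "('i, 'a) relstruct"
  assumes M: "countable (fst M)" "infinite (fst M)"
    and weak: "\<And>A. \<lbrakk>finite A; A \<subseteq> fst M\<rbrakk> \<Longrightarrow>
      \<exists>B. finite B \<and> A \<subseteq> B \<and> B \<subseteq> fst M \<and> amalgamation_pair M (substructure M B) A"
    and S: "S \<in> structures_with_age (age M)" and E: "finite E" and m: "m \<in> fst M"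
  shows "\<exists>T\<in>extension_property_at M (F, G, h, n, m). agree_on E T S"
proof (cases "approximation M S F G h")
  case False
  then show ?thesis using S by (auto simp: extension_property_at_def agree_on_def)
next
  case app: True
  then have G: "finite G" "F \<subseteq> G" "embedding h (substructure (UNIV, S) G) M"
    "amalgamation_pair M (substructure (UNIV, S) G) F"
    by (auto simp: approximation_def)
  have "substructure (UNIV, S) (E \<union> G) \<in> age (UNIV, S)"
    using G(1) E by (intro finite_substructure_in_age) auto
  then have "substructure (UNIV, S) (E \<union> G) \<in> age M"
    using S by (simp add: structures_with_age_def)
  then obtain k where k: "embedding k (substructure (UNIV, S) (E \<union> G)) M" "\<forall>x\<in>F. k x = h x"
    using G(3,4) embedding_substructure_mono[of G "E \<union> G" "(UNIV, S)"]
    unfolding amalgamation_pair_def by fastforce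
  obtain \<pi> T where \<pi>: "isomorphism \<pi> (UNIV, T) M" and agree: "agree_on (E \<union> G) T S"
    and \<pi>k: "\<forall>x\<in>E \<union> G. \<pi> x = k x"
    using finite_embedding_extends_to_copy[OF M _ k(1)] E G(1) by blast
  have bij: "inj \<pi>" "range \<pi> = fst M" using \<pi> by (auto simp: isomorphism_def embedding_def)
  \<comment> \<open>\<open>n\<close> serves the forth step and \<open>n'\<close>, the preimage of \<open>m\<close>, the back step.\<close>
  obtain n' where n': "\<pi> n' = m" using m unfolding bij(2)[symmetric] by blast
  let ?F' = "insert n (insert n' F)"
  have "finite (\<pi> ` ?F')" using finite_subset[OF G(2,1)] by simp
  moreover have "\<pi> ` ?F' \<subseteq> fst M" unfolding bij(2)[symmetric] by blast
  ultimately obtain B where B: "finite B" "\<pi> ` ?F' \<subseteq> B" "B \<subseteq> fst M"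
    "amalgamation_pair M (substructure M B) (\<pi> ` ?F')"
    using weak by meson
  let ?G' = "\<pi> -` B"
  have \<pi>G': "\<pi> ` ?G' = B" using B(3) bij(2) by (simp add: Int_absorb2)
  have iso: "isomorphism \<pi> (substructure (UNIV, T) ?G') (substructure M B)"
    using isomorphism_restrict[OF \<pi>, of ?G'] \<pi>G' by simp
  have "?F' \<subseteq> ?G'" using B(2) by blast
  then have "amalgamation_pair M (substructure (UNIV, T) ?G') ?F'"
    by (intro amalgamation_pair_isomorphism[OF iso _ B(4)]) simp
  moreover have "finite ?G'" using B(1) bij(1) by (rule finite_vimageI)
  moreover have "embedding \<pi> (substructure (UNIV, T) ?G') M"
    using \<pi> by (intro embedding_restrict_substructure) (auto simp: isomorphism_def)
  ultimately have "approximation M T ?F' ?G' \<pi>"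
    using \<open>?F' \<subseteq> ?G'\<close> by (simp add: approximation_def)
  then have "extends_approximation M T F h n m ?F' ?G' \<pi>"
    using \<pi>k k(2) G(2) n' by (auto simp: extends_approximation_def)
  moreover have "T \<in> structures_with_age (age M)"
    using age_isomorphism[OF \<pi>] by (simp add: structures_with_age_def)
  ultimately have "T \<in> extension_property_at M (F, G, h, n, m)"
    by (auto simp: extension_property_at_def)
  then show ?thesis using agree agree_on_mono by blast
qed

text \<open>
  The back-and-forth construction: at step \<open>k\<close> the point \<open>k\<close> enters the domain and the \<open>k\<close>-th element
  of \<open>M\<close> enters the range. The values on the sets \<open>F k\<close> stabilize and define the isomorphism.
\<close>
lemma isomorphic_if_extension_properties:
  fixes M :: "('i, 'a) relstruct"
  assumes M: "countable (fst M)" "infinite (fst M)"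
    and ext: "\<And>F G h n m. \<lbrakk>m \<in> fst M; approximation M S F G h\<rbrakk> \<Longrightarrow>
      \<exists>F' G' h'. extends_approximation M S F h n m F' G' h'"
  shows "isomorphic (UNIV, S) M"
proof -
  let ?m = "from_nat_into (fst M)"
  have mM: "?m k \<in> fst M" for k using M(2) by (intro from_nat_into) auto
  define P where "P = (\<lambda>(F, G, h). approximation M S F G h)"
  define R where "R k = (\<lambda>(F, G :: nat set, h) (F', G', h').
      extends_approximation M S F h k (?m k) F' G' h')" for k
  \<comment> \<open>The empty approximation: every member of the age embeds into \<open>M\<close>.\<close>
  have "\<exists>x. P x"
  proof -
    have "embedding h (substructure (UNIV, S) {}) M" for h
      by (simp add: embedding_def)
    moreover have "amalgamation_pair M (substructure (UNIV, S) {}) {}"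
      by (auto simp: amalgamation_pair_def age_def)
    ultimately show ?thesis by (auto simp: P_def approximation_def)
  qed
  moreover have "\<exists>y. P y \<and> R k x y" if "P x" for x k
  proof -
    obtain F G h where x: "x = (F, G, h)" by (cases x)
    then have "approximation M S F G h" using that by (simp add: P_def)
    from ext[OF mM this, of k k] obtain F' G' h'
      where "extends_approximation M S F h k (?m k) F' G' h'" by blast
    then show ?thesis
      by (intro exI[of _ "(F', G', h')"]) (simp add: P_def R_def x extends_approximation_def)
  qed
  ultimately obtain s where s: "\<And>k. P (s k)" "\<And>k. R k (s k) (s (Suc k))"
    using dependent_nat_choice[of "\<lambda>_. P" R] by metis
  define F where "F k = fst (s k)" for k
  define G where "G k = fst (snd (s k))" for k
  define h where "h k = snd (snd (s k))" for k
  have s_eq: "s k = (F k, G k, h k)" for k by (simp add: F_def G_def h_def)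
  have app: "approximation M S (F k) (G k) (h k)" for k
    using s(1)[of k] by (simp add: P_def s_eq)
  have next_step: "extends_approximation M S (F k) (h k) k (?m k) (F (Suc k)) (G (Suc k)) (h (Suc k))"
    for k
    using s(2)[of k] by (simp add: R_def s_eq)
  have F_mono: "F j \<subseteq> F k" if "j \<le> k" for j k
  proof -
    have "F i \<subseteq> F (Suc i)" for i using next_step[of i] by (simp add: extends_approximation_def)
    from lift_Suc_mono_le[of F, OF this that] show ?thesis .
  qed
  have h_stable: "h k x = h j x" if "j \<le> k" "x \<in> F j" for j k x
    using that(1)
  proof (induction k rule: dec_induct)
    case (step i)
    have "x \<in> F i" using F_mono[OF step.hyps(1)] that(2) by blast
    then show ?case using step.IH next_step[of i]
      by (auto simp: extends_approximation_def)
  qed simp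
  have FSuc: "x \<in> F (Suc x)" for x using next_step[of x] by (auto simp: extends_approximation_def)
  define \<phi> where "\<phi> x = h (Suc x) x" for x
  have \<phi>: "\<phi> x = h k x" if "x \<in> F k" for x k
    unfolding \<phi>_def
    by (metis FSuc h_stable nle_le that)
  have loc: "\<exists>k. x \<in> G k \<and> y \<in> G k \<and> \<phi> x = h k x \<and> \<phi> y = h k y" for x y
  proof -
    have "x \<in> F (Suc (max x y))" "y \<in> F (Suc (max x y))"
      using FSuc[of x] FSuc[of y] F_mono by (meson Suc_le_mono max.cobounded1 max.cobounded2 subsetD)+
    then show ?thesis using \<phi> app by (meson approximation_def subsetD)
  qed
  have emb: "embedding (h k) (substructure (UNIV, S) (G k)) M" for k
    using app by (simp add: approximation_def)
  have "\<phi> x \<in> fst M" for x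
    using loc[of x x] emb unfolding embedding_def by force
  moreover have "inj \<phi>"
  proof (rule injI)
    fix x y assume eq: "\<phi> x = \<phi> y"
    obtain k where "x \<in> G k" "y \<in> G k" "\<phi> x = h k x" "\<phi> y = h k y" using loc by blast
    then show "x = y" using eq emb[of k] by (auto simp: embedding_def dest: inj_onD)
  qed
  moreover have "(x, y) \<in> S i \<longleftrightarrow> (\<phi> x, \<phi> y) \<in> snd M i" for x y i
  proof -
    obtain k where "x \<in> G k" "y \<in> G k" "\<phi> x = h k x" "\<phi> y = h k y" using loc by blast
    then show ?thesis using emb[of k] by (auto simp: embedding_def)
  qed
  moreover have "fst M \<subseteq> range \<phi>"
  proof
    fix m assume "m \<in> fst M"
    then obtain k where k: "m = ?m k" using from_nat_into_surj[OF M(1)] by metis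
    then have "m \<in> h (Suc k) ` F (Suc k)" using next_step[of k] by (simp add: extends_approximation_def)
    then obtain x where "x \<in> F (Suc k)" "m = h (Suc k) x" by blast
    then have "m = \<phi> x" using \<phi> by simp
    then show "m \<in> range \<phi>" by blast
  qed
  ultimately have "isomorphism \<phi> (UNIV, S) M"
    by (auto simp: isomorphism_def embedding_def)
  then show ?thesis by (auto simp: isomorphic_def)
qed

text \<open>
  The hypothesis is a weak form of injectivity of \<open>M\<close> with respect to its age. In an
  ultrahomogeneous structure one could take \<open>B = A\<close>.
\<close>
theorem weak_fraisse_limit_ageI:
  fixes M :: "('i, 'a) relstruct"
  assumes rel: "relational_structure M" and M: "countable (fst M)" "infinite (fst M)"
    and weak: "\<And>A. \<lbrakk>finite A; A \<subseteq> fst M\<rbrakk> \<Longrightarrow>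
      \<exists>B. finite B \<and> A \<subseteq> B \<and> B \<subseteq> fst M \<and> amalgamation_pair M (substructure M B) A"
  shows "weak_fraisse_limit (age M) M"
proof -
  let ?I = "(SIGMA F:{F. finite F}. SIGMA G:{G. finite G}.
      (G \<rightarrow>\<^sub>E fst M) \<times> (UNIV :: nat set) \<times> fst M) :: (nat set \<times> nat set \<times> (nat \<Rightarrow> 'a) \<times> nat \<times> 'a) set"
  let ?U = "{S \<in> structures_with_age (age M). isomorphic (UNIV, S) M}"
  have cfin: "countable {F :: nat set. finite F}"
    using countable_Collect_finite by simp
  have "countable ?I"
    by (intro countable_SIGMA cfin) (use M(1) in \<open>auto intro!: countable_SIGMA countable_PiE\<close>)
  then have "comeager_in (structure_space (age M)) ?U"
  proof (rule comeager_in_structure_spaceI[where D = "extension_property_at M"])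
    fix S assume S: "S \<in> structures_with_age (age M)" and all: "\<forall>i\<in>?I. S \<in> extension_property_at M i"
    have "\<exists>F' G' h'. extends_approximation M S F h n m F' G' h'"
      if m: "m \<in> fst M" and app: "approximation M S F G h" for F G h n m
    proof -
      \<comment> \<open>Only the values of \<open>h\<close> on the finite set \<open>G\<close> matter, which makes countably many
          extension properties suffice.\<close>
      let ?h = "restrict h G"
      have G: "finite G" "F \<subseteq> G" "h ` G \<subseteq> fst M"
        using app by (auto simp: approximation_def embedding_def)
      then have "(F, G, ?h, n, m) \<in> ?I" using m finite_subset by auto
      then have "S \<in> extension_property_at M (F, G, ?h, n, m)" using all by blast
      moreover have "approximation M S F G ?h"
        using app by (subst approximation_cong[of G _ h]) simp_all
      ultimately obtain F' G' h' where "extends_approximation M S F ?h n m F' G' h'"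
        by (auto simp: extension_property_at_def)
      then have "extends_approximation M S F h n m F' G' h'"
        using G(2) by (auto simp: extends_approximation_def)
      then show ?thesis by blast
    qed
    then show "S \<in> ?U" using isomorphic_if_extension_properties[OF M] S by blast
  next
    show "openin (structure_space (age M)) (extension_property_at M i)" if "i \<in> ?I" for i
      using openin_extension_property_at by (cases i) fast
    show "\<exists>T\<in>extension_property_at M i. agree_on E T S"
      if "i \<in> ?I" "S \<in> structures_with_age (age M)" "finite E" for i S E
    proof -
      obtain F G h n m where i: "i = (F, G, h, n, m)" by (cases i)
      then have "m \<in> fst M" using that(1) by simp
      then show ?thesis unfolding i by (intro dense_extension_property_at M weak that(2,3))
    qed
  qed blast
  then show ?thesis using rel M by (simp add: weak_fraisse_limit_def)
qed


section \<open>Linear orders\<close>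

definition pullback :: "'a set \<Rightarrow> ('a \<Rightarrow> 'b) \<Rightarrow> 'b rel \<Rightarrow> 'a rel" where
  "pullback A f m = {(x, y). x \<in> A \<and> y \<in> A \<and> (f x, f y) \<in> m}"

lemma linear_order_on_pullback:
  assumes "linear_order_on B m" "inj_on f A" "f ` A \<subseteq> B"
  shows "linear_order_on A (pullback A f m)"
proof -
  have m: "refl_on B m" "trans m" "antisym m" "total_on B m"
    using assms(1) by (auto simp: order_on_defs)
  have "trans (pullback A f m)"
    using m(2) by (auto simp: trans_def pullback_def)
  moreover have "antisym (pullback A f m)"
    using m(3) assms(2) by (auto simp: antisym_def pullback_def dest: inj_onD)
  moreover have "refl_on A (pullback A f m)"
    using m(1) assms(3) by (auto simp: refl_on_def pullback_def)
  moreover have "total_on A (pullback A f m)"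
    unfolding total_on_def pullback_def
  proof (intro ballI impI)
    fix x y assume "x \<in> A" "y \<in> A" "x \<noteq> y"
    then have "f x \<in> B" "f y \<in> B" "f x \<noteq> f y" using assms(2,3) by (auto dest: inj_onD)
    then show "(x, y) \<in> {(x, y). x \<in> A \<and> y \<in> A \<and> (f x, f y) \<in> m} \<or>
        (y, x) \<in> {(x, y). x \<in> A \<and> y \<in> A \<and> (f x, f y) \<in> m}"
      using m(4) \<open>x \<in> A\<close> \<open>y \<in> A\<close> by (auto simp: total_on_def)
  qed
  ultimately show ?thesis by (auto simp: order_on_defs pullback_def)
qed

lemma linear_order_on_UNIV_if_finite_restrictions:
  assumes "\<And>B. finite B \<Longrightarrow> linear_order_on B (Restr r B)"
  shows "linear_order_on UNIV r"
proof -
  have B: "refl_on B (Restr r B)" "trans (Restr r B)" "antisym (Restr r B)"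
    "total_on B (Restr r B)" if "finite B" for B
    using assms[OF that] by (auto simp: order_on_defs)
  have "(x, x) \<in> r" for x using B(1)[of "{x}"] by (auto simp: refl_on_def)
  then have "refl_on UNIV r" by (simp add: refl_on_def)
  moreover have "trans r"
  proof (rule transI)
    fix x y z assume "(x, y) \<in> r" "(y, z) \<in> r"
    then show "(x, z) \<in> r" using transD[OF B(2)[of "{x, y, z}"], of x y z] by auto
  qed
  moreover have "antisym r"
  proof (rule antisymI)
    fix x y assume "(x, y) \<in> r" "(y, x) \<in> r"
    then show "x = y" using antisymD[OF B(3)[of "{x, y}"], of x y] by auto
  qed
  moreover have "total_on UNIV r"
    unfolding total_on_def
  proof (intro ballI impI)
    fix x y :: 'a assume "x \<noteq> y"
    then show "(x, y) \<in> r \<or> (y, x) \<in> r" using B(4)[of "{x, y}"] by (auto simp: total_on_def)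
  qed
  ultimately show ?thesis by (simp add: order_on_defs)
qed

text \<open>
  The new point \<open>z\<close> is placed directly above the initial segment \<open>D\<close> of \<open>X\<close>.
\<close>
lemma linear_order_on_insert_cut:
  assumes r: "linear_order_on UNIV r" and "z \<notin> X" "D \<subseteq> X"
    and D: "\<And>x y. \<lbrakk>x \<in> X; y \<in> D; (x, y) \<in> r\<rbrakk> \<Longrightarrow> x \<in> D"
  shows "linear_order_on (insert z X) (Restr r X \<union> {(z, z)} \<union> D \<times> {z} \<union> {z} \<times> (X - D))"
    (is "linear_order_on _ ?l")
proof -
  have r': "refl_on UNIV r" "trans r" "antisym r" "total_on UNIV r"
    using r by (auto simp: order_on_defs)
  have tot: "(x, y) \<in> r \<or> (y, x) \<in> r" for x y
    using r'(1,4) by (cases "x = y") (auto simp: refl_on_def total_on_def)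
  have up: "(x, y) \<in> r" if "x \<in> D" "y \<in> X - D" for x y
    using tot D that assms(3) by blast
  have "trans ?l"
  proof (rule transI)
    fix a b c assume "(a, b) \<in> ?l" "(b, c) \<in> ?l"
    then show "(a, c) \<in> ?l"
      using assms(2,3) D[of a b] D[of b c] up[of a c] transD[OF r'(2), of a b c] by auto
  qed
  moreover have "antisym ?l"
    by (rule antisymI) (use assms(2,3) in \<open>auto dest: antisymD[OF r'(3)]\<close>)
  moreover have "refl_on (insert z X) ?l" using r'(1) by (auto simp: refl_on_def)
  moreover have "total_on (insert z X) ?l" using tot by (auto simp: total_on_def)
  ultimately show ?thesis using assms(3) by (auto simp: order_on_defs)
qed

lemma linear_order_on_cases:
  assumes "linear_order_on B l" "x \<in> B" "y \<in> B"
  shows "(x, y) \<in> l \<or> (y, x) \<in> l"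
  using assms by (cases "x = y") (auto simp: order_on_defs refl_on_def total_on_def)

text \<open>
  Linear orders on a fixed set are maximal among its partial orders, so one inclusion is enough to
  identify two of them.
\<close>
lemma linear_order_on_subset_eq:
  assumes "linear_order_on A l" "linear_order_on A m" "l \<subseteq> m"
  shows "l = m"
proof
  show "m \<subseteq> l"
  proof
    fix z assume z: "z \<in> m"
    obtain x y where xy: "z = (x, y)" by (cases z)
    have "x \<in> A" "y \<in> A" using z assms(2) by (auto simp: order_on_defs xy)
    then have "(x, y) \<in> l \<or> (y, x) \<in> l"
      using assms(1) by (cases "x = y") (auto simp: order_on_defs refl_on_def total_on_def)
    then show "z \<in> l" using assms z by (auto simp: xy order_on_defs dest: antisymD)
  qed
qed (rule assms(3))

lemma linear_order_on_Restr:
  assumes "linear_order_on B l" "A \<subseteq> B"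
  shows "linear_order_on A (Restr l A)"
proof -
  have "pullback A id l = Restr l A" by (auto simp: pullback_def)
  then show ?thesis using linear_order_on_pullback[OF assms(1), of id A] assms(2) by simp
qed

lemma partial_order_on_Int_linear:
  assumes "linear_order_on A l" "linear_order_on A m"
  shows "partial_order_on A (l \<inter> m)"
  using assms by (auto simp: order_on_defs refl_on_def trans_Int antisym_def)


section \<open>Permutations and posets as structures\<close>

lemma embedding_permutation_iff:
  "embedding f (permutation_structure A l1 l2) (permutation_structure B m1 m2) \<longleftrightarrow>
     f ` A \<subseteq> B \<and> inj_on f A \<and>
     (\<forall>x\<in>A. \<forall>y\<in>A. ((x, y) \<in> l1 \<longleftrightarrow> (f x, f y) \<in> m1) \<and> ((x, y) \<in> l2 \<longleftrightarrow> (f x, f y) \<in> m2))"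
  by (auto simp: embedding_def permutation_structure_def all_bool_eq)

lemma embedding_poset_iff:
  "embedding f (poset_structure A l) (poset_structure B m) \<longleftrightarrow>
     f ` A \<subseteq> B \<and> inj_on f A \<and> (\<forall>x\<in>A. \<forall>y\<in>A. (x, y) \<in> l \<longleftrightarrow> (f x, f y) \<in> m)"
  by (auto simp: embedding_def poset_structure_def)

lemma substructure_permutation:
  "substructure (permutation_structure A l1 l2) B = permutation_structure B (Restr l1 B) (Restr l2 B)"
  by (auto simp: substructure_def permutation_structure_def fun_eq_iff)

lemma substructure_poset:
  "substructure (poset_structure A l) B = poset_structure B (Restr l B)"
  by (simp add: substructure_def poset_structure_def)

lemma finite_posets_dim_le_2_eq:
  "finite_posets_dim_le_2 = {poset_structure C (L1 \<inter> L2) | C L1 L2.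
     finite C \<and> linear_order_on C L1 \<and> linear_order_on C L2}"
proof (intro equalityI subsetI)
  fix N :: "(unit, nat) relstruct" assume "N \<in> finite_posets_dim_le_2"
  then obtain C r where C: "N = poset_structure C r" "finite C" "partial_order_on C r"
    "poset_dimension C r \<le> 2"
    by (auto simp: finite_posets_dim_le_2_def)
  then obtain L1 L2 where "linear_order_on C L1" "linear_order_on C L2" "r = L1 \<inter> L2"
    using poset_dimension_le_2_iff by metis
  then show "N \<in> {poset_structure C (L1 \<inter> L2) | C L1 L2.
      finite C \<and> linear_order_on C L1 \<and> linear_order_on C L2}" using C by blast
next
  fix N :: "(unit, nat) relstruct" assume "N \<in> {poset_structure C (L1 \<inter> L2) | C L1 L2.
      finite C \<and> linear_order_on C L1 \<and> linear_order_on C L2}"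
  then obtain C L1 L2 where C: "N = poset_structure C (L1 \<inter> L2)" "finite C"
    "linear_order_on C L1" "linear_order_on C L2" by blast
  have "partial_order_on C (L1 \<inter> L2)" using partial_order_on_Int_linear C by blast
  moreover from this have "poset_dimension C (L1 \<inter> L2) \<le> 2"
    using poset_dimension_le_2_iff C by blast
  ultimately show "N \<in> finite_posets_dim_le_2"
    using C unfolding finite_posets_dim_le_2_def by blast
qed


section \<open>The generic permutation\<close>

text \<open>
  Ultrahomogeneity yields injectivity: the image of \<open>B\<close> under the given embedding of \<open>N\<close> is moved
  onto the image of \<open>B\<close> under \<open>f\<close> by an automorphism.
\<close>
lemma ultrahomogeneous_extension:
  assumes hom: "ultrahomogeneous M" and e: "embedding e N M"
    and B: "finite B" "B \<subseteq> fst N" and f: "embedding f (substructure N B) M"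
  shows "\<exists>k. embedding k N M \<and> (\<forall>x\<in>B. k x = f x)"
proof -
  have eB: "isomorphism e (substructure N B) (substructure M (e ` B))"
    using isomorphism_onto_image[OF embedding_restrict_substructure[OF e B(2)]] by simp
  have fB: "isomorphism f (substructure N B) (substructure M (f ` B))"
    using isomorphism_onto_image[OF f] by simp
  let ?i = "inv_into B e"
  have "isomorphism ?i (substructure M (e ` B)) (substructure N B)"
    using isomorphism_inv_into[OF eB] by simp
  then have "isomorphism (f \<circ> ?i) (substructure M (e ` B)) (substructure M (f ` B))"
    using fB by (rule isomorphism_comp)
  moreover have "finite (e ` B)" "e ` B \<subseteq> fst M" "f ` B \<subseteq> fst M"
    using B e f by (auto simp: embedding_def)
  ultimately obtain g where g: "isomorphism g M M" "\<forall>x\<in>e ` B. g x = (f \<circ> ?i) x"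
    using hom[unfolded ultrahomogeneous_def, rule_format, of "e ` B" "f ` B" "f \<circ> ?i"] by blast
  have "inj_on e B" using e B(2) by (auto simp: embedding_def inj_on_subset)
  then have "\<forall>x\<in>B. (g \<circ> e) x = f x" using g(2) by simp
  moreover have "embedding (g \<circ> e) N M"
    using embedding_comp[OF e, of g M] g(1) by (simp add: isomorphism_def)
  ultimately show ?thesis by blast
qed

locale generic_permutation =
  fixes r1 r2 :: "'a rel"
  assumes fraisse: "fraisse_limit finite_permutations (permutation_structure UNIV r1 r2)"
begin

abbreviation perm where "perm \<equiv> permutation_structure UNIV r1 r2"

lemma age_perm: "age perm = finite_permutations"
  using fraisse by (simp add: fraisse_limit_def)

text \<open>
  That the two relations are linear orders is encoded in the age only, so it is read off from finite
  substructures.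
\<close>
lemma linear_finite_restrictions:
  assumes "finite B"
  shows "linear_order_on B (Restr r1 B) \<and> linear_order_on B (Restr r2 B)"
proof -
  obtain e :: "'a \<Rightarrow> nat" where e: "inj_on e B"
    using finite_imp_inj_to_nat_seg[OF assms] by blast
  let ?i = "inv_into B e"
  let ?l = "pullback (e ` B) ?i"
  have ie: "?i (e x) = x" if "x \<in> B" for x using e that by simp
  have "embedding ?i (permutation_structure (e ` B) (?l r1) (?l r2)) perm"
    unfolding embedding_permutation_iff by (auto simp: pullback_def inj_on_inv_into)
  then have "permutation_structure (e ` B) (?l r1) (?l r2) \<in> age perm"
    unfolding age_def
    using assms by (auto simp: relational_structure_def permutation_structure_def pullback_def)
  then obtain A' l1 l2 where *: "permutation_structure (e ` B) (?l r1) (?l r2) =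
      permutation_structure A' l1 l2" "linear_order_on A' l1" "linear_order_on A' l2"
    unfolding age_perm finite_permutations_def by blast
  have fam: "(\<lambda>b. if b then ?l r1 else ?l r2) = (\<lambda>b. if b then l1 else l2)" "A' = e ` B"
    using *(1) by (auto simp: permutation_structure_def)
  have "linear_order_on (e ` B) (?l r1)" "linear_order_on (e ` B) (?l r2)"
    using *(2,3) fun_cong[OF fam(1), of True] fun_cong[OF fam(1), of False] fam(2) by auto
  then have "linear_order_on B (pullback B e (?l r1))" "linear_order_on B (pullback B e (?l r2))"
    using e by (auto intro: linear_order_on_pullback)
  moreover have "pullback B e (?l m) = Restr m B" for m
  proof -
    have "(x, y) \<in> pullback B e (?l m) \<longleftrightarrow> (x, y) \<in> Restr m B" for x y
      by (cases "x \<in> B"; cases "y \<in> B"; simp add: pullback_def ie)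
    then show ?thesis by auto
  qed
  ultimately show ?thesis by simp
qed

lemma linear: "linear_order_on UNIV r1" "linear_order_on UNIV r2"
  using linear_finite_restrictions by (auto intro: linear_order_on_UNIV_if_finite_restrictions)

lemma finite_permutation_embeds:
  assumes "finite C" "linear_order_on C l1" "linear_order_on C l2"
  shows "\<exists>e. embedding e (permutation_structure C l1 l2) perm"
proof -
  obtain g :: "'b \<Rightarrow> nat" where g: "inj_on g C"
    using finite_imp_inj_to_nat_seg[OF assms(1)] by blast
  let ?i = "inv_into C g"
  let ?N = "permutation_structure (g ` C) (pullback (g ` C) ?i l1) (pullback (g ` C) ?i l2)"
  have "?i ` g ` C \<subseteq> C" using g by auto
  then have "linear_order_on (g ` C) (pullback (g ` C) ?i l)" if "linear_order_on C l" for l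
    using that linear_order_on_pullback[OF that inj_on_inv_into] by blast
  then have "?N \<in> age perm"
    unfolding age_perm finite_permutations_def using assms by blast
  then obtain e where "embedding e ?N perm" by (auto simp: age_def)
  moreover have "embedding g (permutation_structure C l1 l2) ?N"
    unfolding embedding_permutation_iff using g by (auto simp: pullback_def)
  ultimately show ?thesis using embedding_comp by blast
qed

lemma permutation_extension:
  assumes "finite C" "linear_order_on C l1" "linear_order_on C l2" "B \<subseteq> C"
    and "embedding f (permutation_structure B (Restr l1 B) (Restr l2 B)) perm"
  shows "\<exists>k. embedding k (permutation_structure C l1 l2) perm \<and> (\<forall>x\<in>B. k x = f x)"
proof -
  obtain e where e: "embedding e (permutation_structure C l1 l2) perm"
    using finite_permutation_embeds assms(1-3) by blast
  have "ultrahomogeneous perm" using fraisse by (simp add: fraisse_limit_def)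
  moreover have "finite B" using assms(1,4) finite_subset by blast
  moreover have "B \<subseteq> fst (permutation_structure C l1 l2)"
    using assms(4) by (simp add: permutation_structure_def)
  moreover have "embedding f (substructure (permutation_structure C l1 l2) B) perm"
    using assms(5) by (simp add: substructure_permutation)
  ultimately show ?thesis using ultrahomogeneous_extension e by blast
qed

lemma infinite_UNIV: "infinite (UNIV :: 'a set)"
proof
  assume fin: "finite (UNIV :: 'a set)"
  let ?C = "{..card (UNIV :: 'a set)}"
  let ?l = "{(x, y). x \<in> ?C \<and> y \<in> ?C \<and> x \<le> y}"
  have "linear_order_on ?C ?l"
    by (auto simp: order_on_defs refl_on_def trans_def antisym_def total_on_def)
  then obtain e :: "nat \<Rightarrow> 'a" where "embedding e (permutation_structure ?C ?l ?l) perm"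
    using finite_permutation_embeds by blast
  then have "inj_on e ?C" by (simp add: embedding_permutation_iff)
  then have "card ?C \<le> card (UNIV :: 'a set)" using card_inj_on_le fin by blast
  then show False by simp
qed

text \<open>
  Picturing the first order as horizontal and the second one as vertical, there is a point in every
  cell of the grid that a finite set \<open>X\<close> cuts out of the plane.
\<close>
lemma one_point_extension:
  assumes X: "finite X" and D: "D1 \<subseteq> X" "D2 \<subseteq> X"
    and D1: "\<And>x y. \<lbrakk>x \<in> X; y \<in> D1; (x, y) \<in> r1\<rbrakk> \<Longrightarrow> x \<in> D1"
    and D2: "\<And>x y. \<lbrakk>x \<in> X; y \<in> D2; (x, y) \<in> r2\<rbrakk> \<Longrightarrow> x \<in> D2"
  obtains z where "\<And>x. x \<in> X \<Longrightarrow> ((x, z) \<in> r1 \<longleftrightarrow> x \<in> D1) \<and> ((z, x) \<in> r1 \<longleftrightarrow> x \<notin> D1) \<and>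
    ((x, z) \<in> r2 \<longleftrightarrow> x \<in> D2) \<and> ((z, x) \<in> r2 \<longleftrightarrow> x \<notin> D2)"
proof -
  obtain z where z: "z \<notin> X" using ex_new_if_finite[OF infinite_UNIV X] by blast
  let ?l = "\<lambda>r D. Restr r X \<union> {(z, z)} \<union> D \<times> {z} \<union> {z} \<times> (X - D)"
  have lin: "linear_order_on (insert z X) (?l r1 D1)" "linear_order_on (insert z X) (?l r2 D2)"
    by (rule linear_order_on_insert_cut[OF linear(1) z D(1) D1]
        linear_order_on_insert_cut[OF linear(2) z D(2) D2]; assumption)+
  have "embedding id (permutation_structure X (Restr (?l r1 D1) X) (Restr (?l r2 D2) X)) perm"
    unfolding embedding_permutation_iff using z by auto
  then obtain k where k: "embedding k (permutation_structure (insert z X) (?l r1 D1) (?l r2 D2)) perm"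
    "\<forall>x\<in>X. k x = id x"
    using permutation_extension[OF _ lin subset_insertI] X by blast
  show thesis
  proof (rule that[of "k z"])
    fix x assume x: "x \<in> X"
    have "((x, z) \<in> ?l r1 D1 \<longleftrightarrow> (k x, k z) \<in> r1) \<and> ((z, x) \<in> ?l r1 D1 \<longleftrightarrow> (k z, k x) \<in> r1) \<and>
      ((x, z) \<in> ?l r2 D2 \<longleftrightarrow> (k x, k z) \<in> r2) \<and> ((z, x) \<in> ?l r2 D2 \<longleftrightarrow> (k z, k x) \<in> r2)"
      using k(1) x unfolding embedding_permutation_iff by blast
    moreover have "x \<noteq> z" using x z by blast
    ultimately show "((x, k z) \<in> r1 \<longleftrightarrow> x \<in> D1) \<and> ((k z, x) \<in> r1 \<longleftrightarrow> x \<notin> D1) \<and>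
      ((x, k z) \<in> r2 \<longleftrightarrow> x \<in> D2) \<and> ((k z, x) \<in> r2 \<longleftrightarrow> x \<notin> D2)"
      using k(2) x z by auto
  qed
qed

end


section \<open>Recovering the two orders from the poset\<close>

text \<open>
  In a realizer, \<open>l1\<close> and \<open>l2\<close> order the two points of an incomparable pair in opposite ways; which of
  them comes first in \<open>l1\<close> is the orientation of the pair. If a point is incomparable to two points
  that are comparable with each other, the two resulting pairs have the same orientation, since the
  comparable points lie in the same order in \<open>l1\<close> and in \<open>l2\<close>. The next two lemmas state the
  implications that do not already follow from transitivity of \<open>l1\<close>.
\<close>
lemma orientation_transfer_right:
  assumes l: "linear_order_on B l1" "linear_order_on B l2"
    and B: "x \<in> B" "y \<in> B" and "(y, z) \<in> l1 \<inter> l2" "(x, z) \<notin> l1 \<inter> l2" "(y, x) \<notin> l1 \<inter> l2"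
    and "(x, z) \<in> l1"
  shows "(x, y) \<in> l1"
proof (rule ccontr)
  assume "(x, y) \<notin> l1"
  then have "(x, y) \<in> l2" using linear_order_on_cases[OF l(1) B] linear_order_on_cases[OF l(2) B] assms by blast
  then have "(x, z) \<in> l2" using l(2) assms(5) by (auto simp: order_on_defs dest: transD)
  then show False using assms by blast
qed

lemma orientation_transfer_left:
  assumes l: "linear_order_on B l1" "linear_order_on B l2"
    and B: "x \<in> B" "z \<in> B" and "(y, z) \<in> l1 \<inter> l2" "(y, x) \<notin> l1 \<inter> l2" "(x, z) \<notin> l1 \<inter> l2"
    and "(y, x) \<in> l1"
  shows "(z, x) \<in> l1"
proof (rule ccontr)
  assume "(z, x) \<notin> l1"
  then have "(z, x) \<in> l2" using linear_order_on_cases[OF l(1) B] linear_order_on_cases[OF l(2) B] assms by blast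
  then have "(y, x) \<in> l2" using l(2) assms(5) by (auto simp: order_on_defs dest: transD)
  then show False using assms by blast
qed

text \<open>
  The hypotheses come from the following picture. With \<open>r1\<close> horizontal and \<open>r2\<close> vertical, let \<open>p\<close> lie to the upper left of \<open>A\<close>, and let \<open>q\<close> lie above
  all points of \<open>A\<close> in both orders but to the lower right of \<open>p\<close>. An incomparable pair of \<open>A\<close> consists
  of a point \<open>a\<close> and a point \<open>b\<close> to its lower right. The point \<open>s a\<close> is below \<open>a\<close> and below \<open>p\<close> in
  the poset, but vertically so close to \<open>a\<close> that it stays to the upper left of \<open>b\<close>. Then the pairs
  \<open>(p, q)\<close>, \<open>(p, b)\<close>, \<open>(s a, b)\<close>, \<open>(a, b)\<close> all have the same orientation, because
  consecutive ones share a point while their other points are comparable. So the single pair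
  \<open>(p, q)\<close> decides the whole realizer on \<open>A\<close>.
\<close>
lemma realizer_determined_by_orientation:
  assumes r: "linear_order_on UNIV r1" "linear_order_on UNIV r2"
    and l: "linear_order_on B l1" "linear_order_on B l2" "l1 \<inter> l2 = Restr (r1 \<inter> r2) B"
    and B: "A \<subseteq> B" "p \<in> B" "q \<in> B" "s ` A \<subseteq> B"
    and p: "\<And>a. a \<in> A \<Longrightarrow> (a, p) \<notin> r1 \<inter> r2"
    and q: "(p, q) \<notin> r1 \<inter> r2" "\<And>a. a \<in> A \<Longrightarrow> (a, q) \<in> r1 \<inter> r2"
    and s: "\<And>a. a \<in> A \<Longrightarrow> (s a, a) \<in> r1 \<inter> r2 \<and> (s a, p) \<in> r1 \<inter> r2"
      "\<And>a b. \<lbrakk>a \<in> A; b \<in> A; (a, b) \<notin> r2\<rbrakk> \<Longrightarrow> (s a, b) \<notin> r1 \<inter> r2"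
    and pq: "(p, q) \<in> l1"
  shows "Restr l1 A = Restr r1 A \<and> Restr l2 A = Restr r2 A"
proof -
  have R: "(x, y) \<in> l1 \<inter> l2 \<longleftrightarrow> (x, y) \<in> r1 \<inter> r2" if "x \<in> B" "y \<in> B" for x y
    using l(3) that by blast
  have asym: "x = y" if "(x, y) \<in> r1" "(y, x) \<in> r1" for x y
    using r(1) that by (auto simp: order_on_defs dest: antisymD)
  have refl: "(x, x) \<in> r2" for x using r(2) by (auto simp: order_on_defs refl_on_def)
  have key: "(a, b) \<in> l1" if ab: "a \<in> A" "b \<in> A" "(a, b) \<in> r1" "(a, b) \<notin> r2" for a b
  proof -
    have in_B: "a \<in> B" "b \<in> B" "s a \<in> B" using ab B by auto
    have "(p, b) \<in> l1"
      using orientation_transfer_right[OF l(1,2), of p b q] R p q pq in_B B ab(2) by blast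
    moreover have "(s a, p) \<in> l1" using R[of "s a" p] s(1) ab(1) in_B B by blast
    ultimately have sb: "(s a, b) \<in> l1"
      using l(1) by (auto simp: order_on_defs dest: transD)
    have "(b, a) \<notin> r1" using asym ab refl by blast
    then show ?thesis
      using orientation_transfer_left[OF l(1,2), of b a "s a"] R in_B s ab sb by blast
  qed
  have "Restr r1 A \<subseteq> Restr l1 A"
  proof (rule subrelI)
    fix a b assume "(a, b) \<in> Restr r1 A"
    then show "(a, b) \<in> Restr l1 A" using key R[of a b] B(1) by (cases "(a, b) \<in> r2") auto
  qed
  then have 1: "Restr r1 A = Restr l1 A"
    by (intro linear_order_on_subset_eq[OF linear_order_on_Restr[OF r(1) subset_UNIV]
          linear_order_on_Restr[OF l(1) B(1)]])
  have "Restr r2 A \<subseteq> Restr l2 A"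
  proof (rule subrelI)
    fix a b assume "(a, b) \<in> Restr r2 A"
    then have ab: "(a, b) \<in> r2" "a \<in> A" "b \<in> A" by auto
    have "(a, b) \<in> l2"
    proof (cases "(a, b) \<in> l1")
      case True
      then show ?thesis using 1 ab R[of a b] B(1) by blast
    next
      case False
      then have "(a, b) \<notin> r1" using 1 ab by blast
      then have "(b, a) \<in> r1" "a \<noteq> b"
        using linear_order_on_cases[OF r(1), of a b] linear_order_on_cases[OF r(1), of a a] by auto
      then have "(b, a) \<notin> r2"
        using ab(1) r(2) by (auto simp: order_on_defs dest: antisymD)
      then have "(b, a) \<notin> l1 \<inter> l2" using R[of b a] ab B(1) by blast
      moreover have "(b, a) \<in> l1" using 1 \<open>(b, a) \<in> r1\<close> ab by blast
      ultimately show ?thesis using linear_order_on_cases[OF l(2), of a b] ab B(1) by blast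
    qed
    then show "(a, b) \<in> Restr l2 A" using ab by blast
  qed
  then have "Restr r2 A = Restr l2 A"
    by (intro linear_order_on_subset_eq[OF linear_order_on_Restr[OF r(2) subset_UNIV]
          linear_order_on_Restr[OF l(2) B(1)]])
  with 1 show ?thesis by simp
qed

context generic_permutation
begin

abbreviation poset where "poset \<equiv> poset_structure UNIV (r1 \<inter> r2)"

text \<open>
  The points \<open>p\<close>, \<open>q\<close> and \<open>s a\<close> exist in the generic permutation. As \<open>p\<close> and \<open>q\<close> are incomparable,
  \<open>p\<close> precedes \<open>q\<close> in one of the two orders of a realizer, and taking that order first reduces
  the claim to the preceding lemma.
\<close>
lemma realizer_unique_up_to_swap:
  assumes A: "finite A"
  obtains B where "finite B" "A \<subseteq> B"
    "\<And>l1 l2. \<lbrakk>linear_order_on B l1; linear_order_on B l2; l1 \<inter> l2 = Restr (r1 \<inter> r2) B\<rbrakk> \<Longrightarrow>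
      Restr l1 A = Restr r1 A \<and> Restr l2 A = Restr r2 A \<or>
      Restr l1 A = Restr r2 A \<and> Restr l2 A = Restr r1 A"
proof -
  have anti: "x = y" if "(x, y) \<in> r2" "(y, x) \<in> r2" for x y
    using linear(2) that by (auto simp: order_on_defs dest: antisymD)
  have tr: "(x, z) \<in> r2" if "(x, y) \<in> r2" "(y, z) \<in> r2" for x y z
    using linear(2) that by (auto simp: order_on_defs dest: transD)
  obtain p where p: "\<And>a. a \<in> A \<Longrightarrow> (p, a) \<in> r1 \<and> (a, p) \<notin> r1 \<and> (a, p) \<in> r2 \<and> (p, a) \<notin> r2"
  proof (rule one_point_extension[OF A, of "{}" A])
    fix z assume "\<And>x. x \<in> A \<Longrightarrow>
      ((x, z) \<in> r1 \<longleftrightarrow> x \<in> {}) \<and> ((z, x) \<in> r1 \<longleftrightarrow> x \<notin> {}) \<and>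
      ((x, z) \<in> r2 \<longleftrightarrow> x \<in> A) \<and> ((z, x) \<in> r2 \<longleftrightarrow> x \<notin> A)"
    then show thesis by (intro that[of z]) auto
  qed auto
  obtain q where q: "\<And>a. a \<in> insert p A \<Longrightarrow> (a, q) \<in> r1 \<and> (q, a) \<notin> r1"
    "\<And>a. a \<in> A \<Longrightarrow> (a, q) \<in> r2" "(p, q) \<notin> r2"
  proof (rule one_point_extension[of "insert p A" "insert p A" A])
    fix z assume "\<And>x. x \<in> insert p A \<Longrightarrow>
      ((x, z) \<in> r1 \<longleftrightarrow> x \<in> insert p A) \<and> ((z, x) \<in> r1 \<longleftrightarrow> x \<notin> insert p A) \<and>
      ((x, z) \<in> r2 \<longleftrightarrow> x \<in> A) \<and> ((z, x) \<in> r2 \<longleftrightarrow> x \<notin> A)"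
    moreover have "p \<notin> A" using p by blast
    ultimately show thesis by (intro that[of z]) auto
  qed (use A p in auto)
  have "\<exists>c. (c, a) \<in> r1 \<inter> r2 \<and> (c, p) \<in> r1 \<inter> r2 \<and>
      (\<forall>b\<in>A. (a, b) \<notin> r2 \<longrightarrow> (c, b) \<notin> r1 \<inter> r2)" if a: "a \<in> A" for a
  proof (rule one_point_extension[of "insert p A" "{}" "{x \<in> A. (a, x) \<notin> r2}"])
    fix x y assume "x \<in> insert p A" "y \<in> {x \<in> A. (a, x) \<notin> r2}" "(x, y) \<in> r2"
    then show "x \<in> {x \<in> A. (a, x) \<notin> r2}" using p tr by blast
  next
    fix z assume "\<And>x. x \<in> insert p A \<Longrightarrow>
      ((x, z) \<in> r1 \<longleftrightarrow> x \<in> {}) \<and> ((z, x) \<in> r1 \<longleftrightarrow> x \<notin> {}) \<and>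
      ((x, z) \<in> r2 \<longleftrightarrow> x \<in> {x \<in> A. (a, x) \<notin> r2}) \<and> ((z, x) \<in> r2 \<longleftrightarrow> x \<notin> {x \<in> A. (a, x) \<notin> r2})"
    moreover have "(a, a) \<in> r2" using linear_order_on_cases[OF linear(2), of a a] by simp
    moreover have "p \<notin> A" using p by blast
    ultimately show ?thesis using a by (intro exI[of _ z]) auto
  qed (use A in auto)
  then obtain s where s: "\<And>a. a \<in> A \<Longrightarrow> (s a, a) \<in> r1 \<inter> r2 \<and> (s a, p) \<in> r1 \<inter> r2"
    "\<And>a b. \<lbrakk>a \<in> A; b \<in> A; (a, b) \<notin> r2\<rbrakk> \<Longrightarrow> (s a, b) \<notin> r1 \<inter> r2"
    by metis
  let ?B = "A \<union> {p, q} \<union> s ` A"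
  show thesis
  proof (rule that[of ?B])
    fix l1 l2 assume l: "linear_order_on ?B l1" "linear_order_on ?B l2"
      "l1 \<inter> l2 = Restr (r1 \<inter> r2) ?B"
    have "(q, p) \<notin> l1 \<inter> l2" using l(3) q(1) by blast
    then have "(p, q) \<in> l1 \<or> (p, q) \<in> l2"
      using linear_order_on_cases[OF l(1), of p q] linear_order_on_cases[OF l(2), of p q] by blast
    moreover have "Restr m1 A = Restr r1 A \<and> Restr m2 A = Restr r2 A"
      if "linear_order_on ?B m1" "linear_order_on ?B m2" "m1 \<inter> m2 = Restr (r1 \<inter> r2) ?B"
        "(p, q) \<in> m1" for m1 m2
      by (rule realizer_determined_by_orientation[OF linear that(1-3), of A p q s])
        (use p q s that(4) in auto)
    ultimately show "Restr l1 A = Restr r1 A \<and> Restr l2 A = Restr r2 A \<or>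
        Restr l1 A = Restr r2 A \<and> Restr l2 A = Restr r1 A"
      using l by (metis Int_commute)
  qed (use A in auto)
qed

lemma age_poset: "age poset = finite_posets_dim_le_2"
proof (intro equalityI subsetI)
  fix N :: "(unit, nat) relstruct" assume N: "N \<in> age poset"
  obtain C R where NC: "N = (C, R)" by (cases N)
  obtain f where f: "embedding f N poset" "finite C" "R () \<subseteq> C \<times> C"
    using N by (auto simp: age_def relational_structure_def NC)
  have "R = (\<lambda>_. R ())" by (simp add: fun_eq_iff)
  then have N_eq: "N = poset_structure C (R ())" by (simp add: NC poset_structure_def)
  have inj: "inj_on f C" using f(1) by (simp add: N_eq embedding_poset_iff)
  have "R () = pullback C f r1 \<inter> pullback C f r2"
    using f(1,3) unfolding N_eq embedding_poset_iff pullback_def by auto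
  then have "N = poset_structure C (pullback C f r1 \<inter> pullback C f r2)" using N_eq by simp
  moreover have "linear_order_on C (pullback C f r1)" "linear_order_on C (pullback C f r2)"
    using linear_order_on_pullback[OF _ inj] linear by auto
  ultimately show "N \<in> finite_posets_dim_le_2"
    unfolding finite_posets_dim_le_2_eq using f(2) by blast
next
  fix N :: "(unit, nat) relstruct" assume "N \<in> finite_posets_dim_le_2"
  then obtain C L1 L2 where C: "N = poset_structure C (L1 \<inter> L2)" "finite C"
    "linear_order_on C L1" "linear_order_on C L2"
    unfolding finite_posets_dim_le_2_eq by blast
  obtain e where "embedding e (permutation_structure C L1 L2) perm"
    using finite_permutation_embeds C by blast
  then have "embedding e N poset"
    unfolding C(1) embedding_permutation_iff embedding_poset_iff by auto
  moreover have "L1 \<subseteq> C \<times> C" using C(3) by (simp add: order_on_defs)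
  ultimately show "N \<in> age poset"
    using C(1,2) by (auto simp: age_def relational_structure_def poset_structure_def)
qed

text \<open>
  Both a realizer of \<open>N\<close>, pulled back along \<open>e\<close>, and the orders of the generic permutation, pulled
  back along \<open>f\<close>, realize the poset on \<open>B\<close>. On \<open>A\<close> they therefore agree after exchanging the two
  orders of \<open>N\<close> if necessary, and \<open>f\<close> restricted to \<open>A\<close> becomes an embedding of permutations.
\<close>
lemma amalgamation_pair_exists:
  assumes A: "finite A"
  shows "\<exists>B. finite B \<and> A \<subseteq> B \<and> amalgamation_pair poset (substructure poset B) A"
proof -
  obtain B where B: "finite B" "A \<subseteq> B"
    and uniq: "\<And>l1 l2. \<lbrakk>linear_order_on B l1; linear_order_on B l2; l1 \<inter> l2 = Restr (r1 \<inter> r2) B\<rbrakk> \<Longrightarrow>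
      Restr l1 A = Restr r1 A \<and> Restr l2 A = Restr r2 A \<or>
      Restr l1 A = Restr r2 A \<and> Restr l2 A = Restr r1 A"
    using realizer_unique_up_to_swap[OF A] by blast
  have "amalgamation_pair poset (substructure poset B) A"
    unfolding amalgamation_pair_def
  proof (intro ballI allI impI, elim conjE)
    fix N :: "(unit, nat) relstruct" and e f
    assume "N \<in> age poset"
      and ef: "embedding e (substructure poset B) N" "embedding f (substructure poset B) poset"
    then obtain C L1 L2 where C: "N = poset_structure C (L1 \<inter> L2)" "finite C"
      "linear_order_on C L1" "linear_order_on C L2"
      unfolding age_poset finite_posets_dim_le_2_eq by blast
    have e: "e ` B \<subseteq> C" "inj_on e B"
      "\<And>x y. x \<in> B \<Longrightarrow> y \<in> B \<Longrightarrow> (x, y) \<in> r1 \<inter> r2 \<longleftrightarrow> (e x, e y) \<in> L1 \<inter> L2"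
      using ef(1) unfolding C(1) substructure_poset embedding_poset_iff by auto
    have f: "inj_on f B"
      "\<And>x y. x \<in> B \<Longrightarrow> y \<in> B \<Longrightarrow> (x, y) \<in> r1 \<inter> r2 \<longleftrightarrow> (f x, f y) \<in> r1 \<inter> r2"
      using ef(2) unfolding substructure_poset embedding_poset_iff by auto
    let ?e = "pullback B e" and ?f = "pullback B f"
    have e_uniq: "Restr (?e L1) A = Restr r1 A \<and> Restr (?e L2) A = Restr r2 A \<or>
        Restr (?e L1) A = Restr r2 A \<and> Restr (?e L2) A = Restr r1 A"
      by (rule uniq) (use e linear_order_on_pullback[OF C(3) e(2,1)]
          linear_order_on_pullback[OF C(4) e(2,1)] in \<open>auto simp: pullback_def\<close>)
    have f_uniq: "Restr (?f r1) A = Restr r1 A \<and> Restr (?f r2) A = Restr r2 A \<or>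
        Restr (?f r1) A = Restr r2 A \<and> Restr (?f r2) A = Restr r1 A"
      by (rule uniq) (use f linear_order_on_pullback[OF linear(1) f(1)]
          linear_order_on_pullback[OF linear(2) f(1)] in \<open>auto simp: pullback_def\<close>)
    obtain K1 K2 where K: "K1 \<inter> K2 = L1 \<inter> L2" "linear_order_on C K1" "linear_order_on C K2"
      "Restr (?e K1) A = Restr (?f r1) A" "Restr (?e K2) A = Restr (?f r2) A"
    proof (cases "Restr (?e L1) A = Restr (?f r1) A \<and> Restr (?e L2) A = Restr (?f r2) A")
      case True
      then show ?thesis using that[of L1 L2] C by blast
    next
      case False
      then have "Restr (?e L2) A = Restr (?f r1) A" "Restr (?e L1) A = Restr (?f r2) A"
        using e_uniq f_uniq by metis+
      then show ?thesis using that[of L2 L1] C by blast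
    qed
    have K': "((e x, e y) \<in> K1 \<longleftrightarrow> (f x, f y) \<in> r1) \<and> ((e x, e y) \<in> K2 \<longleftrightarrow> (f x, f y) \<in> r2)"
      if "x \<in> A" "y \<in> A" for x y
    proof -
      have "(x, y) \<in> Restr (?e K1) A \<longleftrightarrow> (x, y) \<in> Restr (?f r1) A"
        "(x, y) \<in> Restr (?e K2) A \<longleftrightarrow> (x, y) \<in> Restr (?f r2) A"
        using K(4,5) by simp_all
      then show ?thesis using that B(2) by (auto simp: pullback_def)
    qed
    let ?g = "f \<circ> inv_into A e"
    have ie: "inv_into A e (e x) = x" if "x \<in> A" for x
      using that e(2) B(2) by (meson inj_on_subset inv_into_f_f)
    have "inj_on ?g (e ` A)"
      using ie f(1) B(2) by (auto simp: inj_on_def subset_iff)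
    then have g: "embedding ?g (permutation_structure (e ` A) (Restr K1 (e ` A)) (Restr K2 (e ` A))) perm"
      unfolding embedding_permutation_iff using ie K' by auto
    have "e ` A \<subseteq> C" using e(1) B(2) by blast
    from permutation_extension[OF C(2) K(2,3) this g]
    obtain k where k: "embedding k (permutation_structure C K1 K2) perm" "\<forall>x\<in>e ` A. k x = ?g x"
      by blast
    have "embedding k N poset"
      using k(1) unfolding C(1) K(1)[symmetric] embedding_permutation_iff embedding_poset_iff by auto
    moreover have "\<forall>x\<in>A. k (e x) = f x" using k(2) ie by simp
    ultimately show "\<exists>k. embedding k N poset \<and> (\<forall>x\<in>A. k (e x) = f x)" by blast
  qed
  then show ?thesis using B by blast
qed

end

theorem theoremC:
  fixes r1 r2 r :: "rat rel"
  assumes generic_permutation: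
      "fraisse_limit finite_permutations (permutation_structure UNIV r1 r2)"
    and r_def: "r = {(a, b). (a, b) \<in> r1 \<and> (a, b) \<in> r2}"
  shows "weak_fraisse_limit finite_posets_dim_le_2 (poset_structure UNIV r)"
proof -
  interpret generic_permutation r1 r2 by unfold_locales (rule generic_permutation)
  have "r = r1 \<inter> r2" using r_def by blast
  moreover have "weak_fraisse_limit (age poset) poset"
    by (rule weak_fraisse_limit_ageI)
      (use infinite_UNIV amalgamation_pair_exists in
        \<open>auto simp: relational_structure_def poset_structure_def\<close>)
  ultimately show ?thesis by (simp add: age_poset)
qed

end
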